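(* Let $R$ be a finite commutative co-local ring with identity which is not a field, and let $N$ be the non-trivial ideal contained in all proper non-trivial ideals of $R$. Then $$\gamma^o(\Gamma(R)) \geq \left\lceil \frac{|N^*|}{2} \right\rceil,$$ where $N^*=N\setminus\{0\}$. Furthermore, this bound is sharp: equality holds for $R=\mathbb{Z}_9$.
   Context: A commutative ring $R$ is co-local if it contains a non-trivial ideal that is contained in every non-trivial proper ideal of $R$. $Z(R)^*$ denotes the set of nonzero zero-divisors of $R$. The zero-divisor graph $\Gamma(R)$ is the simple graph with vertex set $Z(R)^*$, in which distinct $u,v$ are adjacent if and only if $uv=0$. For a simple graph $\Gamma=(V,E)$, a set $S\subseteq V$ and a vertex $v$, let $\delta_S(v)$ be the number of neighbors of $v$ in $S$ and $\overline{S}=V\setminus S$. A nonempty set $S\subseteq V$ is a global offensive alliance if $\delta_S(v)\geq \delta_{\overline{S}}(v)+1$ for every $v\in\overline{S}$. $\gamma^o(\Gamma)$ is the minimum cardinality of a global offensive alliance of $\Gamma$. *)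

theory Defs
  imports
    "HOL-Algebra.Ideal"
    "HOL-Number_Theory.Residues"
    "Graph_Theory.Pair_Digraph"
begin

text \<open>A non-trivial ideal is one different from the zero ideal.\<close>

definition least_nontrivial_ideal :: "('a, 'b) ring_scheme \<Rightarrow> 'a set \<Rightarrow> bool" where
  "least_nontrivial_ideal R N \<longleftrightarrow>
     ideal N R \<and> N \<noteq> {\<zero>\<^bsub>R\<^esub>} \<and>
     (\<forall>I. ideal I R \<and> I \<noteq> {\<zero>\<^bsub>R\<^esub>} \<and> I \<noteq> carrier R \<longrightarrow> N \<subseteq> I)"

definition co_local :: "('a, 'b) ring_scheme \<Rightarrow> bool" where
  "co_local R \<longleftrightarrow> (\<exists>N. least_nontrivial_ideal R N)"

definition nonzero_zero_divisors :: "('a, 'b) ring_scheme \<Rightarrow> 'a set" where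
  "nonzero_zero_divisors R =
     {a \<in> carrier R. a \<noteq> \<zero>\<^bsub>R\<^esub> \<and>
        (\<exists>b \<in> carrier R. b \<noteq> \<zero>\<^bsub>R\<^esub> \<and> a \<otimes>\<^bsub>R\<^esub> b = \<zero>\<^bsub>R\<^esub>)}"

text \<open>
  A finite simple graph is a \<^locale>\<open>pair_graph\<close>: each edge is represented by its two
  opposite arcs.
\<close>

definition zero_divisor_graph :: "('a, 'b) ring_scheme \<Rightarrow> 'a pair_pre_digraph" where
  "zero_divisor_graph R =
     \<lparr> pverts = nonzero_zero_divisors R,
       parcs = {(u, v). u \<in> nonzero_zero_divisors R \<and> v \<in> nonzero_zero_divisors R \<and>
                        u \<noteq> v \<and> u \<otimes>\<^bsub>R\<^esub> v = \<zero>\<^bsub>R\<^esub>} \<rparr>"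

lemma pair_graph_zero_divisor_graph:
  assumes "cring R" and "finite (carrier R)"
  shows "pair_graph (zero_divisor_graph R)"
proof -
  interpret cring R by fact
  let ?V = "nonzero_zero_divisors R"
  have V: "finite ?V" "?V \<subseteq> carrier R"
    using assms(2) by (auto simp: nonzero_zero_divisors_def)
  have "parcs (zero_divisor_graph R) \<subseteq> ?V \<times> ?V"
    by (auto simp: zero_divisor_graph_def)
  then have "finite (parcs (zero_divisor_graph R))"
    using V(1) by (meson finite_SigmaI finite_subset)
  moreover have "sym (parcs (zero_divisor_graph R))"
    using V(2) by (auto simp: zero_divisor_graph_def sym_def subset_iff m_comm)
  ultimately show ?thesis
    using V(1) by unfold_locales (auto simp: zero_divisor_graph_def symmetric_def)
qed

definition degree_in :: "'a pair_pre_digraph \<Rightarrow> 'a set \<Rightarrow> 'a \<Rightarrow> nat" where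
  "degree_in G S v = card {u \<in> S. (v, u) \<in> parcs G}"

definition global_offensive_alliance :: "'a pair_pre_digraph \<Rightarrow> 'a set \<Rightarrow> bool" where
  "global_offensive_alliance G S \<longleftrightarrow>
     S \<noteq> {} \<and> S \<subseteq> pverts G \<and>
     (\<forall>v \<in> pverts G - S. degree_in G S v \<ge> degree_in G (pverts G - S) v + 1)"

text \<open>Meaningful for finite graphs with at least one vertex; then the whole vertex set is an alliance.\<close>

definition global_offensive_alliance_number :: "'a pair_pre_digraph \<Rightarrow> nat" where
  "global_offensive_alliance_number G = Min (card ` {S. global_offensive_alliance G S})"

end

theory Submission
  imports Defs
begin

text \<open>
  For every nonzero zero-divisor \<open>z\<close> the annihilator of \<open>z\<close> is a proper non-trivial ideal, so it
  contains \<open>N\<close>. As a finite ring that is not a field has such a \<open>z\<close>, the elements of \<open>N\<^sup>*\<close> are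
  vertices adjacent to all other vertices. An alliance \<open>S\<close> either contains \<open>N\<^sup>*\<close> or misses some
  vertex of full degree; the alliance condition at the latter says that \<open>S\<close> contains at least half
  of all vertices.
\<close>

section \<open>Annihilators and zero-divisors in finite commutative rings\<close>

lemma (in cring) annihilator_ideal:
  assumes z: "z \<in> carrier R"
  shows "ideal {x \<in> carrier R. z \<otimes> x = \<zero>} R"
proof (rule idealI)
  show "subgroup {x \<in> carrier R. z \<otimes> x = \<zero>} (add_monoid R)"
    using z by (intro add.subgroupI) (auto simp: r_distr r_minus simp flip: a_inv_def)
  show "x \<otimes> a \<in> {x \<in> carrier R. z \<otimes> x = \<zero>}"
    if "a \<in> {x \<in> carrier R. z \<otimes> x = \<zero>}" "x \<in> carrier R" for a x
    using that z by (auto simp: m_lcomm)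
  show "a \<otimes> x \<in> {x \<in> carrier R. z \<otimes> x = \<zero>}"
    if "a \<in> {x \<in> carrier R. z \<otimes> x = \<zero>}" "x \<in> carrier R" for a x
    using that z by (auto simp flip: m_assoc)
qed (rule ring_axioms)

text \<open>Multiplication by a nonzero \<open>a\<close> is injective when there are no
  zero-divisors, hence surjective on the finite carrier, so it takes the value
  \<open>\<one>\<close>.\<close>

lemma (in cring) finite_no_zero_divisors_imp_field:
  assumes fin: "finite (carrier R)" and one: "\<one> \<noteq> \<zero>"
    and no_zd: "nonzero_zero_divisors R = {}"
  shows "field R"
proof (rule cring_fieldI)
  show "Units R = carrier R - {\<zero>}"
  proof
    have "\<zero> \<notin> Units R"
      using one by (auto simp: Units_def)
    then show "Units R \<subseteq> carrier R - {\<zero>}"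
      using Units_closed by blast
    show "carrier R - {\<zero>} \<subseteq> Units R"
    proof
      fix a assume a: "a \<in> carrier R - {\<zero>}"
      have "inj_on (\<lambda>x. a \<otimes> x) (carrier R)"
      proof (rule inj_onI)
        fix x y assume xy: "x \<in> carrier R" "y \<in> carrier R" "a \<otimes> x = a \<otimes> y"
        then have "a \<otimes> (x \<ominus> y) = \<zero>"
          using a by (simp add: minus_eq r_distr r_minus r_neg)
        moreover have "x \<ominus> y \<in> carrier R"
          using xy by simp
        ultimately have "x \<ominus> y = \<zero>"
          using no_zd a unfolding nonzero_zero_divisors_def by blast
        then show "x = y"
          using xy by simp
      qed
      moreover have "(\<lambda>x. a \<otimes> x) ` carrier R \<subseteq> carrier R"
        using a by auto
      ultimately have "(\<lambda>x. a \<otimes> x) ` carrier R = carrier R"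
        using fin by (simp add: endo_inj_surj)
      then obtain b where "b \<in> carrier R" "a \<otimes> b = \<one>"
        by (metis imageE one_closed)
      then show "a \<in> Units R"
        using a m_comm[of a b] by (auto simp: Units_def)
    qed
  qed
qed

lemma (in cring) least_ideal_annihilates_zero_divisors:
  assumes N: "least_nontrivial_ideal R N"
    and z: "z \<in> nonzero_zero_divisors R" and x: "x \<in> N"
  shows "z \<otimes> x = \<zero>"
proof -
  let ?A = "{x \<in> carrier R. z \<otimes> x = \<zero>}"
  have zc: "z \<in> carrier R" and nz: "z \<noteq> \<zero>"
    using z by (auto simp: nonzero_zero_divisors_def)
  have "?A \<noteq> {\<zero>}"
    using z by (auto simp: nonzero_zero_divisors_def)
  moreover have "\<one> \<notin> ?A"
    using zc nz by simp
  then have "?A \<noteq> carrier R"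
    by blast
  ultimately have "N \<subseteq> ?A"
    using N annihilator_ideal[OF zc] by (auto simp: least_nontrivial_ideal_def)
  then show ?thesis
    using x by blast
qed

text \<open>One nonzero zero-divisor \<open>z\<close> exists because \<open>R\<close> is not a
  field. All of \<open>N\<close> annihilates it, so the same \<open>z\<close> is the nonzero
  cofactor for every element of \<open>N - {\<zero>}\<close>.\<close>

lemma (in cring) least_ideal_nonzero_zero_divisors:
  assumes N: "least_nontrivial_ideal R N"
    and fin: "finite (carrier R)" and nf: "\<not> field R"
  shows "N - {\<zero>} \<subseteq> nonzero_zero_divisors R"
proof -
  interpret N: ideal N R
    using N by (simp add: least_nontrivial_ideal_def)
  \<comment> \<open>In the zero ring the only ideal is \<open>{\<zero>}\<close>, which
    \<open>N\<close> is not.\<close>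
  have "\<one> \<noteq> \<zero>"
  proof
    assume "\<one> = \<zero>"
    then have "carrier R = {\<zero>}"
      by (rule one_zeroD)
    then show False
      using N N.Icarr additive_subgroup.zero_closed[OF N.additive_subgroup_axioms] by (auto simp: least_nontrivial_ideal_def)
  qed
  then obtain z where z: "z \<in> nonzero_zero_divisors R"
    using finite_no_zero_divisors_imp_field[OF fin] nf by blast
  show ?thesis
  proof
    fix x assume x: "x \<in> N - {\<zero>}"
    then have "z \<otimes> x = \<zero>"
      using least_ideal_annihilates_zero_divisors[OF N z] by blast
    then show "x \<in> nonzero_zero_divisors R"
      using x z N.Icarr m_comm[of x z] by (auto simp: nonzero_zero_divisors_def)
  qed
qed

section \<open>Global offensive alliances in finite graphs\<close>

lemma global_offensive_alliance_card_ge: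
  assumes fin: "finite (pverts G)" and D: "D \<subseteq> pverts G"
    and full: "\<And>v. v \<in> D \<Longrightarrow> {u. (v, u) \<in> parcs G} = pverts G - {v}"
    and S: "global_offensive_alliance G S"
  shows "card D \<le> 2 * card S"
proof (cases "D \<subseteq> S")
  case True
  have "finite S"
    using S fin finite_subset by (auto simp: global_offensive_alliance_def)
  then show ?thesis
    using card_mono[OF _ True] by simp
next
  case False
  then obtain v where v: "v \<in> D" "v \<notin> S"
    by blast
  let ?T = "pverts G - S"
  have sub: "S \<subseteq> pverts G"
    using S by (simp add: global_offensive_alliance_def)
  have vT: "v \<in> ?T"
    using v D by blast
  \<comment> \<open>As \<open>v\<close> lies outside \<open>S\<close>, the one vertex that it is not
    joined to, namely itself, is lost from \<open>?T\<close> only.\<close>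
  have "{u \<in> S. (v, u) \<in> parcs G} = S" "{u \<in> ?T. (v, u) \<in> parcs G} = ?T - {v}"
    using full[OF v(1)] sub v(2) by blast+
  then have "degree_in G S v = card S" "degree_in G ?T v = card ?T - 1"
    using vT fin by (simp_all add: degree_in_def)
  moreover have "degree_in G S v \<ge> degree_in G ?T v + 1"
    using S vT by (auto simp: global_offensive_alliance_def)
  \<comment> \<open>The \<open>- 1\<close> for \<open>v\<close> itself is cancelled by the
    \<open>+ 1\<close> of the alliance condition.\<close>
  ultimately have "card ?T \<le> card S"
    by linarith
  moreover have "card (pverts G) = card S + card ?T"
    using card_Diff_subset[of S "pverts G"] card_mono[OF fin sub] finite_subset[OF sub fin] sub
    by simp
  moreover have "card D \<le> card (pverts G)"
    using D fin by (rule card_mono[rotated])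
  ultimately show ?thesis
    by linarith
qed

lemma finite_global_offensive_alliances:
  "finite (pverts G) \<Longrightarrow> finite {S. global_offensive_alliance G S}"
  by (rule finite_subset[of _ "Pow (pverts G)"]) (auto simp: global_offensive_alliance_def)

lemma global_offensive_alliance_number_ge:
  assumes "finite (pverts G)" and "pverts G \<noteq> {}"
    and "\<And>S. global_offensive_alliance G S \<Longrightarrow> k \<le> card S"
  shows "k \<le> global_offensive_alliance_number G"
proof -
  \<comment> \<open>The degree condition is vacuous here. This makes the set under
    \<open>Min\<close> nonempty.\<close>
  have "global_offensive_alliance G (pverts G)"
    using assms(2) by (simp add: global_offensive_alliance_def)
  then show ?thesis
    using assms finite_global_offensive_alliances[OF assms(1)]
    unfolding global_offensive_alliance_number_def by (subst Min_ge_iff) auto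
qed

lemma global_offensive_alliance_number_le:
  assumes "finite (pverts G)" and "global_offensive_alliance G S"
  shows "global_offensive_alliance_number G \<le> card S"
  using assms finite_global_offensive_alliances[OF assms(1)]
  unfolding global_offensive_alliance_number_def by (intro Min_le) auto

lemma co_local_alliance_number_ge:
  fixes R (structure)
  assumes "cring R" and fin: "finite (carrier R)" and nf: "\<not> field R"
    and N: "least_nontrivial_ideal R N"
  shows "\<lceil>real (card (N - {\<zero>})) / 2\<rceil> \<le> int (global_offensive_alliance_number (zero_divisor_graph R))"
proof -
  interpret cring R by fact
  interpret N: ideal N R
    using N by (simp add: least_nontrivial_ideal_def)
  let ?G = "zero_divisor_graph R" and ?D = "N - {\<zero>}"
  have verts: "pverts ?G = nonzero_zero_divisors R"
    by (simp add: zero_divisor_graph_def)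
  have finV: "finite (pverts ?G)"
    using fin by (simp add: verts nonzero_zero_divisors_def)
  have D: "?D \<subseteq> pverts ?G"
    using least_ideal_nonzero_zero_divisors[OF N fin nf] verts by simp
  have "N \<noteq> {\<zero>}"
    using N by (simp add: least_nontrivial_ideal_def)
  then have ne: "pverts ?G \<noteq> {}"
    using D additive_subgroup.zero_closed[OF N.additive_subgroup_axioms] by blast
  \<comment> \<open>The product of \<open>v\<close> with itself is zero too, but the graph has no
    loops, hence \<open>- {v}\<close>.\<close>
  have full: "{u. (v, u) \<in> parcs ?G} = pverts ?G - {v}" if v: "v \<in> ?D" for v
  proof -
    have "v \<otimes> u = \<zero>" if "u \<in> nonzero_zero_divisors R" for u
      using least_ideal_annihilates_zero_divisors[OF N that, of v] v that N.Icarr m_comm[of v u]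
      by (auto simp: nonzero_zero_divisors_def)
    then show ?thesis
      using v D by (auto simp: zero_divisor_graph_def)
  qed
  \<comment> \<open>This quotient is the ceiling of \<open>card ?D / 2\<close> in natural
    numbers.\<close>
  have "(card ?D + 1) div 2 \<le> card S" if "global_offensive_alliance ?G S" for S
    using global_offensive_alliance_card_ge[OF finV D full that] by linarith
  then have "(card ?D + 1) div 2 \<le> global_offensive_alliance_number ?G"
    by (rule global_offensive_alliance_number_ge[OF finV ne])
  then show ?thesis
    by (simp add: ceiling_le_iff)
qed

section \<open>Sharpness for the integers modulo 9\<close>

lemma residue_ring_9_cring: "cring (residue_ring 9)"
  by (rule residues.cring) (simp add: residues_def)

lemma residue_ring_9_carrier: "carrier (residue_ring 9) = {0, 1, 2, 3, 4, 5, 6, 7, 8}"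
proof -
  have "x \<in> carrier (residue_ring 9) \<longleftrightarrow> x \<in> {0, 1, 2, 3, 4, 5, 6, 7, 8}" for x
    by (simp add: residue_ring_def) presburger
  then show ?thesis
    by blast
qed

lemma residue_ring_9_not_field: "\<not> field (residue_ring 9)"
proof
  assume "field (residue_ring 9)"
  then interpret field "residue_ring 9" .
  show False
    \<comment> \<open>Modulo 9 the square of the nonzero element 3 vanishes.\<close>
    using integral[of 3 3] by (simp add: residue_ring_def)
qed

lemma residue_ring_9_zero_divisors: "nonzero_zero_divisors (residue_ring 9) = {3, 6}"
  unfolding nonzero_zero_divisors_def residue_ring_9_carrier
  by (auto simp: residue_ring_def)

lemma residue_ring_9_ideal_subset:
  assumes "ideal I (residue_ring 9)" and "I \<noteq> {0}"
  shows "{0, 3, 6} \<subseteq> I"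
proof -
  interpret ideal I "residue_ring 9" by fact
  have mult: "(x * a) mod 9 \<in> I" if "a \<in> I" "x \<in> {0..8}" for a x
    using I_l_closed[OF that(1), of x] that(2) by (simp add: residue_ring_def)
  have zero: "0 \<in> I"
    using additive_subgroup.zero_closed[OF additive_subgroup_axioms] by (simp add: residue_ring_def)
  then obtain a where a: "a \<in> I" "a \<noteq> 0"
    using assms(2) by blast
  then have "a \<in> {1, 2, 3, 4, 5, 6, 7, 8}"
    using Icarr[OF a(1)] by (simp add: residue_ring_9_carrier)
  \<comment> \<open>The multiplier 3 sends 1, 4, 7 to 3, the multiplier 6 sends 2, 5, 8 to 3, and 1
    and 2 serve for 3 and 6 respectively.\<close>
  then have "3 \<in> I"
    using mult[OF a(1), of 1] mult[OF a(1), of 2] mult[OF a(1), of 3] mult[OF a(1), of 6] by auto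
  then show ?thesis
    using zero mult[of 3 2] by simp
qed

text \<open>This set is the annihilator of 3.\<close>

lemma residue_ring_9_ideal: "ideal {0, 3, 6} (residue_ring 9)"
proof -
  interpret cring "residue_ring 9"
    by (rule residue_ring_9_cring)
  have "{x \<in> carrier (residue_ring 9). 3 \<otimes>\<^bsub>residue_ring 9\<^esub> x = \<zero>\<^bsub>residue_ring 9\<^esub>} = {0, 3, 6}"
    unfolding residue_ring_9_carrier by (auto simp: residue_ring_def)
  then show ?thesis
    using annihilator_ideal[of 3] by (simp add: residue_ring_9_carrier)
qed

text \<open>One direction gives co-locality; the other identifies the arbitrary \<open>N\<close> of
  the sharpness claim.\<close>

lemma residue_ring_9_least_ideal_iff:
  "least_nontrivial_ideal (residue_ring 9) N \<longleftrightarrow> N = {0, 3, 6}"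
proof -
  have zero: "\<zero>\<^bsub>residue_ring 9\<^esub> = 0"
    by (simp add: residue_ring_def)
  have "1 \<in> carrier (residue_ring 9) - {0, 3, 6}"
    by (simp add: residue_ring_9_carrier)
  then have proper: "{0, 3, 6} \<noteq> carrier (residue_ring 9)"
    by blast
  show ?thesis
  proof
    assume N: "least_nontrivial_ideal (residue_ring 9) N"
    \<comment> \<open>Minimality of \<open>N\<close> applies because \<open>{0, 3, 6}\<close> is
      itself proper and non-trivial; this also rules out the whole ring as \<open>N\<close>.\<close>
    then have "N \<subseteq> {0, 3, 6}"
      using residue_ring_9_ideal proper by (simp add: least_nontrivial_ideal_def zero)
    moreover have "{0, 3, 6} \<subseteq> N"
      using N by (intro residue_ring_9_ideal_subset) (simp_all add: least_nontrivial_ideal_def zero)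
    ultimately show "N = {0, 3, 6}"
      by (rule subset_antisym)
  next
    assume N: "N = {0, 3, 6}"
    show "least_nontrivial_ideal (residue_ring 9) N"
      unfolding least_nontrivial_ideal_def zero N
      using residue_ring_9_ideal residue_ring_9_ideal_subset by auto
  qed
qed

text \<open>The graph is a single edge joining 3 and 6, so one endpoint alone is an alliance: the
  other has one neighbor inside and none outside.\<close>

lemma residue_ring_9_alliance_number_le:
  "global_offensive_alliance_number (zero_divisor_graph (residue_ring 9)) \<le> 1"
proof -
  let ?G = "zero_divisor_graph (residue_ring 9)"
  have verts: "pverts ?G = {3, 6}"
    by (simp add: zero_divisor_graph_def residue_ring_9_zero_divisors)
  have arcs: "parcs ?G = {(3, 6), (6, 3)}"
    unfolding zero_divisor_graph_def residue_ring_9_zero_divisors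
    by (auto simp: residue_ring_def)
  have "{u \<in> {3}. (6, u) \<in> parcs ?G} = {3}" "{u \<in> {6}. (6, u) \<in> parcs ?G} = {}"
    by (auto simp: arcs)
  then have "degree_in ?G {3} 6 = 1" "degree_in ?G {6} 6 = 0"
    by (simp_all only: degree_in_def) simp_all
  moreover have "pverts ?G - {3} = {6}"
    by (simp add: verts)
  ultimately have "global_offensive_alliance ?G {3}"
    by (simp add: global_offensive_alliance_def verts)
  then show ?thesis
    using global_offensive_alliance_number_le[of ?G "{3}"] by (simp add: verts)
qed

theorem theorem2p7:
  shows "(\<forall>(R :: ('a, 'b) ring_scheme) N.
            cring R \<and> finite (carrier R) \<and> co_local R \<and> \<not> field R \<and>
            least_nontrivial_ideal R N \<longrightarrow>
              int (global_offensive_alliance_number (zero_divisor_graph R))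
                \<ge> \<lceil>real (card (N - {\<zero>\<^bsub>R\<^esub>})) / 2\<rceil>)
       \<and> (cring (residue_ring 9) \<and> finite (carrier (residue_ring 9)) \<and>
          co_local (residue_ring 9) \<and> \<not> field (residue_ring 9) \<and>
          (\<forall>N. least_nontrivial_ideal (residue_ring 9) N \<longrightarrow>
             int (global_offensive_alliance_number (zero_divisor_graph (residue_ring 9)))
               = \<lceil>real (card (N - {\<zero>\<^bsub>residue_ring 9\<^esub>})) / 2\<rceil>))"
proof (intro conjI allI impI)
  show "cring (residue_ring 9)"
    by (rule residue_ring_9_cring)
  show fin: "finite (carrier (residue_ring 9))"
    by (simp add: residue_ring_9_carrier)
  show "co_local (residue_ring 9)"
    by (simp add: co_local_def residue_ring_9_least_ideal_iff)
  show "\<not> field (residue_ring 9)"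
    by (rule residue_ring_9_not_field)
  fix N assume N: "least_nontrivial_ideal (residue_ring 9) N"
  then have "N - {\<zero>\<^bsub>residue_ring 9\<^esub>} = {3, 6}"
    unfolding residue_ring_9_least_ideal_iff by (auto simp: residue_ring_def)
  then have "\<lceil>real (card (N - {\<zero>\<^bsub>residue_ring 9\<^esub>})) / 2\<rceil> = 1"
    by simp
  then show "int (global_offensive_alliance_number (zero_divisor_graph (residue_ring 9)))
      = \<lceil>real (card (N - {\<zero>\<^bsub>residue_ring 9\<^esub>})) / 2\<rceil>"
    \<comment> \<open>The general bound at this ring gives at least 1, the alliance
      \<open>{3}\<close> at most 1.\<close>
    using co_local_alliance_number_ge[OF residue_ring_9_cring fin residue_ring_9_not_field N]
      residue_ring_9_alliance_number_le by linarith
qed (auto intro: co_local_alliance_number_ge)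

end
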